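(* Let $\frac12<q<p\le1$, let $\alpha=\frac{1-q}{q}$ and $\beta=\frac{1-p}{p}$, and let $a\ge 1$ be an integer. Then $$\lim_{k\to\infty}\frac{E_{\omega_{ak,k}}^0(T_{ak})}{ak}=1+\frac{2}{a}\cdot\frac{\alpha^{a+2}-a\alpha^{3}+(a-1)\alpha^{2}+\left(\left(a\alpha^{2}-(a+1)\alpha\right)\alpha^{a}+\alpha\right)\beta}{\alpha^{3}-2\alpha^{2}+\alpha-\left(\alpha^{2}-2\alpha+1\right)\alpha^{a}\beta}.$$
   Context: For integers $N,k\ge1$, the environment $\omega_{N,k}$ on the vertices $\{1,\dots,N-1\}$ is $$\omega_{N,k}(x)=\begin{cases}p & x=\left\lfloor i\cdot\frac{N-1}{k}\right\rfloor\text{ for some integer }1\le i\le k,\\ q&\text{otherwise.}\end{cases}$$ The walk in an environment $\omega$ with reflection at the origin is the Markov chain $\{X_n\}_{n\ge0}$ on $\{0,1,\dots,N\}$ with $P(X_{n+1}=i+1\mid X_n=i)=\omega(i)$ and $P(X_{n+1}=i-1\mid X_n=i)=1-\omega(i)$ for $1\le i\le N-1$, and $P(X_{n+1}=1\mid X_n=0)=1$ (the behavior after reaching $N$ is irrelevant). $T_N=\min\{n\ge0\mid X_n=N\}$, and $E_\omega^0$ denotes expectation for the walk in environment $\omega$ started at $X_0=0$. In the claim $N=ak$. *)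

theory Defs
  imports "HOL-Probability.Probability"
begin

definition markov_chain ::
  "'w measure \<Rightarrow> (nat \<Rightarrow> 'w \<Rightarrow> nat) \<Rightarrow> (nat \<Rightarrow> nat pmf) \<Rightarrow> nat \<Rightarrow> bool" where
  "markov_chain M X K x0 \<longleftrightarrow>
     prob_space M \<and>
     (\<forall>n. X n \<in> measurable M (count_space UNIV)) \<and>
     (AE w in M. X 0 w = x0) \<and>
     (\<forall>n s y. \<P>(w in M. \<forall>i\<le>n. X i w = s i) > 0 \<longrightarrow>
        \<P>(w in M. X (Suc n) w = y \<bar> \<forall>i\<le>n. X i w = s i) = pmf (K (s n)) y)"

text \<open>The transition law out of \<open>N\<close> is left arbitrary within \<open>{0..N}\<close>, and states
  above \<open>N\<close> are never reached from a state in \<open>{0..N}\<close>.\<close>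

definition reflected_kernel :: "nat \<Rightarrow> (nat \<Rightarrow> real) \<Rightarrow> (nat \<Rightarrow> nat pmf) \<Rightarrow> bool" where
  "reflected_kernel N \<omega> K \<longleftrightarrow>
     pmf (K 0) 1 = 1 \<and>
     (\<forall>i. 1 \<le> i \<and> i < N \<longrightarrow> pmf (K i) (i + 1) = \<omega> i \<and> pmf (K i) (i - 1) = 1 - \<omega> i) \<and>
     set_pmf (K N) \<subseteq> {0..N}"

definition reflected_walk ::
  "'w measure \<Rightarrow> (nat \<Rightarrow> 'w \<Rightarrow> nat) \<Rightarrow> nat \<Rightarrow> (nat \<Rightarrow> real) \<Rightarrow> nat \<Rightarrow> bool" where
  "reflected_walk M X N \<omega> x0 \<longleftrightarrow> (\<exists>K. reflected_kernel N \<omega> K \<and> markov_chain M X K x0)"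

text \<open>The infimum of the empty set is \<open>\<infinity>\<close>.\<close>

definition first_hit :: "(nat \<Rightarrow> 'w \<Rightarrow> nat) \<Rightarrow> nat \<Rightarrow> 'w \<Rightarrow> enat" where
  "first_hit X N w = Inf {enat n |n. X n w = N}"

definition expected_hit :: "'w measure \<Rightarrow> (nat \<Rightarrow> 'w \<Rightarrow> nat) \<Rightarrow> nat \<Rightarrow> ennreal" where
  "expected_hit M X N = (\<integral>\<^sup>+ w. ennreal_of_enat (first_hit X N w) \<partial>M)"

text \<open>Only the values at \<open>1, \<dots>, N - 1\<close> matter.\<close>

definition env :: "real \<Rightarrow> real \<Rightarrow> nat \<Rightarrow> nat \<Rightarrow> nat \<Rightarrow> real" where
  "env p q N k x =
     (if \<exists>i::nat. 1 \<le> i \<and> i \<le> k \<and> int x = \<lfloor>real i * ((real N - 1) / real k)\<rfloor> then p else q)"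

text \<open>Every environment with values in \<open>[0, 1]\<close> has such a walk, so statements quantified over all realizations
  of the walk are not vacuous. The step at time \<open>n\<close> from \<open>i\<close> is the coordinate \<open>(n, i)\<close> of
  an infinite product.\<close>

fun coord_path :: "nat \<Rightarrow> nat \<Rightarrow> (nat \<times> nat \<Rightarrow> nat) \<Rightarrow> nat" where
  "coord_path x0 0 w = x0"
| "coord_path x0 (Suc n) w = w (n, coord_path x0 n w)"

lemma coord_path_cyl:
  "(\<forall>i\<le>n. coord_path x0 i w = s i) \<longleftrightarrow> s 0 = x0 \<and> (\<forall>i<n. w (i, s i) = s (Suc i))"
proof (induction n)
  case (Suc n)
  have "(\<forall>i\<le>Suc n. coord_path x0 i w = s i) \<longleftrightarrow>
        (\<forall>i\<le>n. coord_path x0 i w = s i) \<and> coord_path x0 (Suc n) w = s (Suc n)"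
    by (auto simp: le_Suc_eq)
  also have "\<dots> \<longleftrightarrow> (\<forall>i\<le>n. coord_path x0 i w = s i) \<and> w (n, s n) = s (Suc n)"
    by auto
  finally show ?case
    using Suc.IH by (auto simp: less_Suc_eq)
qed auto

lemma markov_chain_exists:
  "\<exists>(M :: (nat \<times> nat \<Rightarrow> nat) measure) X. markov_chain M X K x0"
proof -
  define D where "D = (\<lambda>c :: nat \<times> nat. measure_pmf (K (snd c)))"
  define M where "M = PiM UNIV D"
  interpret product_prob_space D UNIV
    by (rule product_prob_spaceI) (simp add: D_def prob_space_measure_pmf)
  have sp: "space M = UNIV"
    by (simp add: M_def D_def space_PiM)
  have meas: "(\<lambda>w. w c) \<in> measurable M (count_space UNIV)" for c
  proof -
    have "(\<lambda>w. w c) \<in> measurable M (D c)"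
      unfolding M_def by (rule measurable_component_singleton) simp
    then show ?thesis
      using measurable_cong_sets[of M M "D c" "count_space UNIV"] by (simp add: D_def)
  qed
  have mX: "coord_path x0 n \<in> measurable M (count_space UNIV)" for n
  proof (induction n)
    case (Suc n)
    have "(\<lambda>w. w (n, coord_path x0 n w)) \<in> measurable M (count_space UNIV)"
      by (rule measurable_compose_countable[OF meas Suc])
    moreover have "coord_path x0 (Suc n) = (\<lambda>w. w (n, coord_path x0 n w))"
      by (simp add: fun_eq_iff)
    ultimately show ?case by simp
  next
    case 0
    have "coord_path x0 0 = (\<lambda>w. x0)" by (simp add: fun_eq_iff)
    then show ?case by simp
  qed
  have cyl: "measure M {w \<in> space M. \<forall>i<n. w (i, s i) = s (Suc i)} =
             (\<Prod>i<n. pmf (K (s i)) (s (Suc i)))" for n s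
  proof -
    let ?J = "(\<lambda>i. (i, s i)) ` {..<n}"
    let ?F = "\<lambda>c. {s (Suc (fst c))}"
    have "{w \<in> space M. \<forall>i<n. w (i, s i) = s (Suc i)} = prod_emb UNIV D ?J (Pi\<^sub>E ?J ?F)"
      by (auto simp: sp prod_emb_iff PiE_iff D_def)
    also have "measure M \<dots> = (\<Prod>c\<in>?J. measure (D c) (?F c))"
      unfolding M_def by (rule measure_PiM_emb) (auto simp: D_def)
    also have "\<dots> = (\<Prod>i<n. pmf (K (s i)) (s (Suc i)))"
      by (subst prod.reindex) (auto simp: inj_on_def D_def measure_pmf_single)
    finally show ?thesis .
  qed
  have "prob_space M"
    unfolding M_def by (rule prob_space_PiM) (simp add: D_def prob_space_measure_pmf)
  moreover have "\<P>(w in M. coord_path x0 (Suc n) w = y \<bar> \<forall>i\<le>n. coord_path x0 i w = s i) =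
      pmf (K (s n)) y"
    if pos: "\<P>(w in M. \<forall>i\<le>n. coord_path x0 i w = s i) > 0" for n s y
  proof -
    have s0: "s 0 = x0"
    proof (rule ccontr)
      assume "s 0 \<noteq> x0"
      then have "{w \<in> space M. \<forall>i\<le>n. coord_path x0 i w = s i} = {}"
        unfolding coord_path_cyl by blast
      then show False using pos by (simp only: measure_empty less_irrefl)
    qed
    define t where "t = s(Suc n := y)"
    have t0: "t 0 = x0" using s0 by (simp add: t_def)
    have eq: "(coord_path x0 (Suc n) w = y \<and> (\<forall>i\<le>n. coord_path x0 i w = s i)) \<longleftrightarrow>
          (\<forall>i\<le>Suc n. coord_path x0 i w = t i)" for w
      by (auto simp: t_def le_Suc_eq simp del: coord_path.simps)
    have "\<P>(w in M. coord_path x0 (Suc n) w = y \<and> (\<forall>i\<le>n. coord_path x0 i w = s i)) =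
          (\<Prod>i<Suc n. pmf (K (t i)) (t (Suc i)))"
      unfolding eq by (simp only: coord_path_cyl t0 cyl simp_thms)
    also have "\<dots> = (\<Prod>i<n. pmf (K (s i)) (s (Suc i))) * pmf (K (s n)) y"
      by (simp add: t_def)
    also have "(\<Prod>i<n. pmf (K (s i)) (s (Suc i))) = \<P>(w in M. \<forall>i\<le>n. coord_path x0 i w = s i)"
      by (simp only: coord_path_cyl s0 cyl simp_thms)
    finally show ?thesis
      using pos by (simp add: cond_prob_def)
  qed
  ultimately have "markov_chain M (coord_path x0) K x0"
    unfolding markov_chain_def using mX by auto
  then show ?thesis by blast
qed

lemma reflected_walk_exists:
  assumes "N \<ge> 1" and "\<And>i. 0 \<le> \<omega> i \<and> \<omega> i \<le> 1"
  shows "\<exists>(M :: (nat \<times> nat \<Rightarrow> nat) measure) X. reflected_walk M X N \<omega> x0"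
proof -
  define K where "K = (\<lambda>i. if i = 0 then return_pmf 1 else if i < N
      then map_pmf (\<lambda>b. if b then i + 1 else i - 1) (bernoulli_pmf (\<omega> i)) else return_pmf i)"
  have "pmf (K i) (i + 1) = \<omega> i \<and> pmf (K i) (i - 1) = 1 - \<omega> i" if "1 \<le> i" "i < N" for i
  proof -
    let ?f = "\<lambda>b. if b then i + 1 else i - 1"
    have inj: "inj ?f" using that by (auto simp: inj_def split: if_splits)
    show ?thesis
      using pmf_map_inj'[OF inj, of "bernoulli_pmf (\<omega> i)" True]
        pmf_map_inj'[OF inj, of "bernoulli_pmf (\<omega> i)" False] that assms(2)[of i]
      by (simp add: K_def)
  qed
  then have "reflected_kernel N \<omega> K"
    using assms(1) by (auto simp: reflected_kernel_def K_def)
  then show ?thesis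
    using markov_chain_exists[of K x0] unfolding reflected_walk_def by blast
qed

end

theory Submission
  imports Defs "HOL-Real_Asymp.Real_Asymp"
begin

text \<open>Let \<open>e x\<close> be the expected number of left steps of the walk before it first moves from
  \<open>x\<close> to \<open>x + 1\<close>; a first-step analysis gives \<open>e 0 = 0\<close> and \<open>e x = \<rho> x * (1 + e (x - 1))\<close> with
  \<open>\<rho> = (1 - \<omega>) / \<omega>\<close>, and the crossing takes \<open>1 + 2 * e x\<close> steps on average. In the environment of the
  theorem \<open>\<rho>\<close> is periodic with period \<open>a\<close> and at most \<open>\<alpha> < 1\<close>, so \<open>e\<close> approaches the periodic solution
  \<open>c + G * \<alpha> ^ (Suc x mod a)\<close> of the recursion exponentially fast, and the average of \<open>e\<close> tends to
  the mean of that solution over one period.\<close>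

subsection \<open>Hitting times of the reflected walk\<close>

text \<open>The number of left moves out of \<open>Suc x\<close> before the crossing is geometric
  with mean \<open>(1 - \<omega> (Suc x)) / \<omega> (Suc x)\<close>. Each of them counts for itself
  and for the \<open>left_steps \<omega> x\<close> moves made on average before the return. The
  value at 0 encodes the reflection.\<close>

fun left_steps :: "(nat \<Rightarrow> real) \<Rightarrow> nat \<Rightarrow> real" where
  "left_steps \<omega> 0 = 0"
| "left_steps \<omega> (Suc x) = (1 - \<omega> (Suc x)) / \<omega> (Suc x) * (1 + left_steps \<omega> x)"

text \<open>A crossing of the edge from \<open>y\<close> to \<open>y + 1\<close> has one right step
  more than left steps, hence the summand. That this purely algebraic quantity is the expected
  hitting time of \<open>N\<close> from \<open>x\<close> is shown for \<open>x = 0\<close> in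
  \<open>expected_hit_eq_mean_hit\<close>.\<close>

definition mean_hit :: "nat \<Rightarrow> (nat \<Rightarrow> real) \<Rightarrow> nat \<Rightarrow> real" where
  "mean_hit N \<omega> x = (\<Sum>y\<in>{x..<N}. 1 + 2 * left_steps \<omega> y)"

lemma left_steps_nonneg:
  assumes "\<And>i. 1 \<le> i \<Longrightarrow> i < N \<Longrightarrow> 0 < \<omega> i \<and> \<omega> i \<le> 1" and "x < N"
  shows "0 \<le> left_steps \<omega> x"
  using assms(2)
proof (induction x)
  case (Suc x)
  then show ?case using assms(1)[of "Suc x"] by simp
qed simp

lemma left_steps_cong:
  assumes "\<And>i. 1 \<le> i \<Longrightarrow> i < N \<Longrightarrow> \<omega> i = \<omega>' i" and "x < N"
  shows "left_steps \<omega> x = left_steps \<omega>' x"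
  using assms(2)
proof (induction x)
  case (Suc x)
  then show ?case using assms(1)[of "Suc x"] by simp
qed simp

lemma mean_hit_nonneg:
  assumes "\<And>i. 1 \<le> i \<Longrightarrow> i < N \<Longrightarrow> 0 < \<omega> i \<and> \<omega> i \<le> 1"
  shows "0 \<le> mean_hit N \<omega> x"
  unfolding mean_hit_def
proof (rule sum_nonneg)
  fix y assume "y \<in> {x..<N}"
  then have "0 \<le> left_steps \<omega> y" by (intro left_steps_nonneg[OF assms]) auto
  then show "0 \<le> 1 + 2 * left_steps \<omega> y" by simp
qed

text \<open>Provides a bound uniform in the state, used to show that the potential \<open>u\<close>
  below tends to 0.\<close>

lemma mean_hit_le:
  assumes "\<And>i. 1 \<le> i \<Longrightarrow> i < N \<Longrightarrow> 0 < \<omega> i \<and> \<omega> i \<le> 1"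
  shows "mean_hit N \<omega> x \<le> mean_hit N \<omega> 0"
  unfolding mean_hit_def
proof (rule sum_mono2)
  fix y assume "y \<in> {0..<N} - {x..<N}"
  then have "0 \<le> left_steps \<omega> y" by (intro left_steps_nonneg[OF assms]) auto
  then show "0 \<le> 1 + 2 * left_steps \<omega> y" by simp
qed auto

lemma mean_hit_step: "x < N \<Longrightarrow> mean_hit N \<omega> x = 1 + 2 * left_steps \<omega> x + mean_hit N \<omega> (Suc x)"
  unfolding mean_hit_def by (subst sum.atLeast_Suc_lessThan) simp_all

text \<open>The recursion of \<open>left_steps\<close> with its denominator cleared is exactly this
  Poisson equation: one step of the walk uses up one unit of time.\<close>

lemma mean_hit_harmonic:
  assumes "1 \<le> x" and "x < N" and "0 < \<omega> x"
  shows "\<omega> x * mean_hit N \<omega> (x + 1) + (1 - \<omega> x) * mean_hit N \<omega> (x - 1) = mean_hit N \<omega> x - 1"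
proof -
  obtain z where z: "x = Suc z" using assms(1) by (cases x) auto
  have "\<omega> x * left_steps \<omega> x = (1 - \<omega> x) * (1 + left_steps \<omega> z)"
    using assms(3) by (simp add: z)
  then show ?thesis
    using mean_hit_step[of x N \<omega>] mean_hit_step[of z N \<omega>] assms(2)
    by (simp add: z algebra_simps del: left_steps.simps)
qed

text \<open>The kernel is prescribed only at the neighbours of \<open>x\<close>. Their probabilities
  already add up to 1, so \<open>K x\<close> is supported there and both sums reduce to at most two
  terms.\<close>

lemma reflected_kernel_expectation:
  assumes K: "reflected_kernel N \<omega> K" and "x < N" and \<omega>: "1 \<le> x \<Longrightarrow> 0 < \<omega> x"
  shows "(\<Sum>y\<le>N. pmf (K x) y) = 1"
    and "(\<Sum>y<N. pmf (K x) y * mean_hit N \<omega> y) = mean_hit N \<omega> x - 1"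
proof -
  define A where "A = (if x = 0 then {1} else {x - 1, x + 1})"
  have A: "A \<subseteq> {..N}" "finite A" using assms(2) by (auto simp: A_def)
  have sA: "(\<Sum>y\<in>A. pmf (K x) y) = 1"
    using K assms(2) by (auto simp: A_def reflected_kernel_def)
  then have "measure (measure_pmf (K x)) A = 1"
    using A by (simp add: measure_measure_pmf_finite)
  then have "set_pmf (K x) \<subseteq> A"
    by (simp add: measure_pmf.prob_eq_1 AE_measure_pmf_iff subset_iff)
  then have z: "pmf (K x) y = 0" if "y \<notin> A" for y
    using that by (auto simp: set_pmf_iff)
  show "(\<Sum>y\<le>N. pmf (K x) y) = 1"
    unfolding sA[symmetric] by (rule sum.mono_neutral_right) (use A z in auto)
  \<comment> \<open>The term \<open>y = N\<close> may be added because
    \<open>mean_hit N \<omega> N\<close> is an empty sum.\<close>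
  have "(\<Sum>y<N. pmf (K x) y * mean_hit N \<omega> y) = (\<Sum>y\<le>N. pmf (K x) y * mean_hit N \<omega> y)"
    by (simp add: lessThan_Suc_atMost[symmetric] mean_hit_def)
  also have "\<dots> = (\<Sum>y\<in>A. pmf (K x) y * mean_hit N \<omega> y)"
    by (rule sum.mono_neutral_right) (use A z in auto)
  also have "\<dots> = mean_hit N \<omega> x - 1"
  proof (cases "x = 0")
    case True
    then show ?thesis
      using K mean_hit_step[of 0 N \<omega>] assms(2) by (simp add: A_def reflected_kernel_def)
  next
    case False
    then have "pmf (K x) (x + 1) = \<omega> x" "pmf (K x) (x - 1) = 1 - \<omega> x"
      using K assms(2) unfolding reflected_kernel_def by auto
    then show ?thesis
      using False mean_hit_harmonic[of x N \<omega>] \<omega> assms(2) by (simp add: A_def)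
  qed
  finally show "(\<Sum>y<N. pmf (K x) y * mean_hit N \<omega> y) = mean_hit N \<omega> x - 1" .
qed

section \<open>Path probabilities and the hitting time as a random variable\<close>

text \<open>The Markov property is given only for complete histories. Since \<open>S\<close> is
  finite, there are finitely many histories inside \<open>S\<close> that end in \<open>x\<close>,
  and summing over them gives the one-step law on this event.\<close>

lemma markov_chain_restricted_step:
  assumes mc: "markov_chain M X K x0" and S: "finite S" and "x \<in> S"
  shows "\<P>(w in M. (\<forall>i\<le>n. X i w \<in> S) \<and> X n w = x \<and> X (Suc n) w = y) =
         \<P>(w in M. (\<forall>i\<le>n. X i w \<in> S) \<and> X n w = x) * pmf (K x) y"
proof -
  interpret prob_space M using mc by (simp add: markov_chain_def)
  have [measurable]: "X m \<in> measurable M (count_space UNIV)" for m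
    using mc by (simp add: markov_chain_def)
  \<comment> \<open>Extensional functions make this set of histories finite, and two distinct ones
    differ at some time up to \<open>n\<close>, so their events are disjoint.\<close>
  define P where "P = {s \<in> {..n} \<rightarrow>\<^sub>E S. s n = x}"
  have "finite ({..n} \<rightarrow>\<^sub>E S)" using S by (intro finite_PiE) auto
  then have fP: "finite P" unfolding P_def by auto
  \<comment> \<open>The product form extends the conditional law to histories of probability 0,
    where both sides vanish.\<close>
  have cyl: "\<P>(w in M. (\<forall>i\<le>n. X i w = s i) \<and> X (Suc n) w = y) =
      \<P>(w in M. \<forall>i\<le>n. X i w = s i) * pmf (K (s n)) y" for s
  proof (cases "\<P>(w in M. \<forall>i\<le>n. X i w = s i) > 0")
    case True
    then have "\<P>(w in M. X (Suc n) w = y \<bar> \<forall>i\<le>n. X i w = s i) = pmf (K (s n)) y"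
      using mc unfolding markov_chain_def by blast
    then show ?thesis using True by (simp add: cond_prob_def field_simps conj_commute)
  next
    case False
    then have 0: "\<P>(w in M. \<forall>i\<le>n. X i w = s i) = 0"
      by (simp add: zero_less_measure_iff)
    have "\<P>(w in M. (\<forall>i\<le>n. X i w = s i) \<and> X (Suc n) w = y) \<le> \<P>(w in M. \<forall>i\<le>n. X i w = s i)"
      by (rule finite_measure_mono) auto
    then show ?thesis using 0 by (simp add: measure_le_0_iff)
  qed
  \<comment> \<open>Stated for a general \<open>Q\<close> because it is applied twice: to the event
    of the next step and to the trivial event.\<close>
  have split: "\<P>(w in M. (\<forall>i\<le>n. X i w \<in> S) \<and> X n w = x \<and> Q w) =
      (\<Sum>s\<in>P. \<P>(w in M. (\<forall>i\<le>n. X i w = s i) \<and> Q w))"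
    if [measurable]: "Measurable.pred M Q" for Q
  proof -
    have "{w \<in> space M. (\<forall>i\<le>n. X i w \<in> S) \<and> X n w = x \<and> Q w} =
        (\<Union>s\<in>P. {w \<in> space M. (\<forall>i\<le>n. X i w = s i) \<and> Q w})" (is "?L = ?R")
    proof (intro equalityI subsetI)
      fix w assume w: "w \<in> ?L"
      then have "restrict (\<lambda>i. X i w) {..n} \<in> P" by (auto simp: P_def)
      then show "w \<in> ?R" using w by (intro UN_I[of "restrict (\<lambda>i. X i w) {..n}"]) auto
    next
      fix w assume "w \<in> ?R"
      then show "w \<in> ?L" by (auto simp: P_def PiE_iff)
    qed
    moreover have "disjoint_family_on (\<lambda>s. {w \<in> space M. (\<forall>i\<le>n. X i w = s i) \<and> Q w}) P"
      unfolding disjoint_family_on_def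
    proof (intro ballI impI)
      fix s t assume "s \<in> P" "t \<in> P" "s \<noteq> t"
      then have "\<exists>i\<le>n. s i \<noteq> t i"
        unfolding P_def by (metis (mono_tags, lifting) PiE_ext atMost_iff mem_Collect_eq)
      then show "{w \<in> space M. (\<forall>i\<le>n. X i w = s i) \<and> Q w} \<inter>
          {w \<in> space M. (\<forall>i\<le>n. X i w = t i) \<and> Q w} = {}"
        by auto
    qed
    ultimately show ?thesis
      using fP by (subst finite_measure_finite_Union[symmetric]) auto
  qed
  have "\<P>(w in M. (\<forall>i\<le>n. X i w \<in> S) \<and> X n w = x \<and> X (Suc n) w = y) =
      (\<Sum>s\<in>P. \<P>(w in M. \<forall>i\<le>n. X i w = s i) * pmf (K x) y)"
    by (subst split) (auto simp: cyl P_def intro!: sum.cong)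
  also have "\<dots> = \<P>(w in M. (\<forall>i\<le>n. X i w \<in> S) \<and> X n w = x) * pmf (K x) y"
    using split[of "\<lambda>_. True"] by (simp add: sum_distrib_right)
  finally show ?thesis .
qed

text \<open>The infimum is rewritten as a \<open>LEAST\<close> with default \<infinity>, a form in
  which measurability follows from that of the single events \<open>X n w = N\<close>.\<close>

lemma measurable_first_hit:
  assumes [measurable]: "\<And>n. X n \<in> measurable M (count_space UNIV)"
  shows "first_hit X N \<in> measurable M (count_space UNIV)"
proof -
  have "first_hit X N w = (if \<exists>n. X n w = N then enat (LEAST n. X n w = N) else \<infinity>)" for w
  proof (cases "\<exists>n. X n w = N")
    case True
    then have "Inf {enat n |n. X n w = N} = enat (LEAST n. X n w = N)"
      by (intro cInf_eq_minimum) (auto intro: LeastI_ex Least_le)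
    then show ?thesis using True by (simp add: first_hit_def)
  next
    case False
    then show ?thesis by (simp add: first_hit_def top_enat_def)
  qed
  then have "first_hit X N = (\<lambda>w. if \<exists>n. X n w = N then enat (LEAST n. X n w = N) else \<infinity>)"
    by auto
  moreover have "(\<lambda>w. if \<exists>n. X n w = N then enat (LEAST n. X n w = N) else \<infinity>)
      \<in> measurable M (count_space UNIV)"
    by measurable
  ultimately show ?thesis by simp
qed

lemma less_first_hit_iff: "enat n < first_hit X N w \<longleftrightarrow> (\<forall>i\<le>n. X i w \<noteq> N)"
proof
  assume *: "enat n < first_hit X N w"
  show "\<forall>i\<le>n. X i w \<noteq> N"
  proof (intro allI impI notI)
    fix i assume i: "i \<le> n" "X i w = N"
    then have "first_hit X N w \<le> enat i" unfolding first_hit_def by (auto intro: Inf_lower)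
    also have "\<dots> \<le> enat n" using i by simp
    finally show False using * by simp
  qed
next
  assume *: "\<forall>i\<le>n. X i w \<noteq> N"
  have "enat (Suc n) \<le> first_hit X N w"
    unfolding first_hit_def by (rule Inf_greatest) (use * not_less_eq_eq in auto)
  then show "enat n < first_hit X N w" by (simp add: Suc_ile_eq)
qed

text \<open>A potential argument: the mean of \<open>mean_hit\<close> over the paths still alive at
  time \<open>n\<close> starts at \<open>mean_hit N \<omega> 0\<close>, drops in each step by the
  survival probability, and tends to 0. Hence the survival probabilities sum to
  \<open>mean_hit N \<omega> 0\<close>, and this sum is the expected hitting time.\<close>

lemma expected_hit_eq_mean_hit:
  assumes walk: "reflected_walk M X N \<omega> 0" and "N \<ge> 1"
    and \<omega>: "\<And>i. 1 \<le> i \<Longrightarrow> i < N \<Longrightarrow> 0 < \<omega> i \<and> \<omega> i \<le> 1"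
  shows "expected_hit M X N = ennreal (mean_hit N \<omega> 0)"
proof -
  obtain K where K: "reflected_kernel N \<omega> K" and mc: "markov_chain M X K 0"
    using walk by (auto simp: reflected_walk_def)
  interpret prob_space M using mc by (simp add: markov_chain_def)
  have X_meas [measurable]: "X m \<in> measurable M (count_space UNIV)" for m
    using mc by (simp add: markov_chain_def)
  have X0: "AE w in M. X 0 w = 0" using mc by (simp add: markov_chain_def)
  \<comment> \<open>Survival is expressed as staying below \<open>N\<close> instead of avoiding
    \<open>N\<close>, which confines the paths to a finite set of states; \<open>survive\<close>
    shows that the two agree almost surely.\<close>
  define B where "B n = (\<lambda>w. \<forall>i\<le>n. X i w < N)" for n
  have [measurable]: "Measurable.pred M (B n)" for n unfolding B_def by measurable
  have B_Suc: "B (Suc n) w \<longleftrightarrow> B n w \<and> X (Suc n) w < N" for n w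
    by (auto simp: B_def le_Suc_eq)
  define f where "f n x = \<P>(w in M. B n w \<and> X n w = x)" for n x
  have step: "\<P>(w in M. B n w \<and> X n w = x \<and> X (Suc n) w = y) = f n x * pmf (K x) y"
    if "x < N" for n x y
    using markov_chain_restricted_step[OF mc, of "{..<N}" x n y] that by (simp add: B_def f_def)
  have split: "\<P>(w in M. B n w \<and> Q w) = (\<Sum>x<N. \<P>(w in M. B n w \<and> X n w = x \<and> Q w))"
    if [measurable]: "Measurable.pred M Q" for n Q
  proof -
    have "{w \<in> space M. B n w \<and> Q w} = (\<Union>x<N. {w \<in> space M. B n w \<and> X n w = x \<and> Q w})"
      by (auto simp: B_def)
    then show ?thesis
      by (subst finite_measure_finite_Union[symmetric]) (auto simp: disjoint_family_on_def)
  qed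
  have Bf: "\<P>(w in M. B n w) = (\<Sum>x<N. f n x)" for n
    using split[of "\<lambda>_. True" n] by (simp add: f_def)

  \<comment> \<open>A surviving path cannot jump over \<open>N\<close>: the transition probabilities
    into \<open>{0..N}\<close> sum to 1, so the restricted event has the full probability of
    \<open>B n\<close>.\<close>
  have stay: "AE w in M. B n w \<longrightarrow> X (Suc n) w \<le> N" for n
  proof -
    have "\<P>(w in M. B n w \<and> X (Suc n) w \<le> N) =
        (\<Sum>y\<le>N. \<P>(w in M. B n w \<and> X (Suc n) w = y))"
    proof -
      have "{w \<in> space M. B n w \<and> X (Suc n) w \<le> N} =
          (\<Union>y\<le>N. {w \<in> space M. B n w \<and> X (Suc n) w = y})"
        by auto
      then show ?thesis
        by (subst finite_measure_finite_Union[symmetric]) (auto simp: disjoint_family_on_def)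
    qed
    also have "\<dots> = (\<Sum>y\<le>N. \<Sum>x<N. f n x * pmf (K x) y)"
      by (subst split) (auto simp: step intro!: sum.cong)
    also have "\<dots> = (\<Sum>x<N. f n x * (\<Sum>y\<le>N. pmf (K x) y))"
      by (subst sum.swap) (simp add: sum_distrib_left)
    also have "\<dots> = \<P>(w in M. B n w)"
      using reflected_kernel_expectation(1)[OF K] \<omega> by (simp add: Bf)
    finally have eq: "\<P>(w in M. B n w \<and> X (Suc n) w \<le> N) = \<P>(w in M. B n w)" .
    have "\<P>(w in M. B n w \<and> \<not> X (Suc n) w \<le> N) =
        measure M ({w \<in> space M. B n w} - {w \<in> space M. B n w \<and> X (Suc n) w \<le> N})"
      by (rule arg_cong[where f = "measure M"]) auto
    also have "\<dots> = 0"
      by (subst finite_measure_Diff) (auto simp: eq)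
    finally have "AE w in M. \<not> (B n w \<and> \<not> X (Suc n) w \<le> N)"
      by (subst (asm) prob_eq_0) auto
    then show ?thesis by eventually_elim auto
  qed
  have survive: "AE w in M. (\<forall>i\<le>n. X i w \<noteq> N) \<longleftrightarrow> B n w" for n
  proof (induction n)
    case 0
    show ?case using X0 by eventually_elim (use \<open>N \<ge> 1\<close> in \<open>auto simp: B_def\<close>)
  next
    case (Suc n)
    show ?case using Suc stay[of n] by eventually_elim (auto simp: B_Suc le_Suc_eq)
  qed

  \<comment> \<open>The potential: the expectation of \<open>mean_hit\<close> at time
    \<open>n\<close> over the surviving paths.\<close>
  define u where "u n = (\<Sum>x<N. f n x * mean_hit N \<omega> x)" for n
  have u0: "u 0 = mean_hit N \<omega> 0"
  proof -
    have "f 0 x = (if x = 0 then 1 else 0)" if "x < N" for x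
    proof (cases "x = 0")
      case True
      have "AE w in M. B 0 w \<and> X 0 w = x"
        using X0 by eventually_elim (use True that in \<open>simp add: B_def\<close>)
      then show ?thesis using True by (simp add: f_def prob_Collect_eq_1)
    next
      case False
      have "AE w in M. \<not> (B 0 w \<and> X 0 w = x)"
        using X0 by eventually_elim (use False in simp)
      then show ?thesis using False by (simp add: f_def prob_Collect_eq_0)
    qed
    then have "u 0 = (\<Sum>x<N. if x = 0 then mean_hit N \<omega> x else 0)"
      unfolding u_def by (intro sum.cong) auto
    then show ?thesis using \<open>N \<ge> 1\<close> by simp
  qed
  \<comment> \<open>By the Poisson equation every surviving path loses one unit on average; paths
    that arrive at \<open>N\<close> carry the value 0 and leave no boundary term.\<close>
  have u_Suc: "u (Suc n) = u n - \<P>(w in M. B n w)" for n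
  proof -
    have "f (Suc n) y = (\<Sum>x<N. f n x * pmf (K x) y)" if "y < N" for y
    proof -
      have "f (Suc n) y = \<P>(w in M. B n w \<and> X (Suc n) w = y)"
        unfolding f_def B_Suc using that
        by (intro arg_cong[where f = "measure M"]) auto
      then show ?thesis by (subst (asm) split) (auto simp: step)
    qed
    then have "u (Suc n) = (\<Sum>y<N. \<Sum>x<N. f n x * (pmf (K x) y * mean_hit N \<omega> y))"
      by (simp add: u_def sum_distrib_right mult.assoc)
    also have "\<dots> = (\<Sum>x<N. f n x * (\<Sum>y<N. pmf (K x) y * mean_hit N \<omega> y))"
      by (subst sum.swap) (simp add: sum_distrib_left)
    also have "\<dots> = (\<Sum>x<N. f n x * (mean_hit N \<omega> x - 1))"
      using reflected_kernel_expectation(2)[OF K] \<omega> by simp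
    also have "\<dots> = u n - \<P>(w in M. B n w)"
      by (simp add: u_def Bf algebra_simps sum_subtractf)
    finally show ?thesis .
  qed
  have partial: "(\<Sum>i<n. \<P>(w in M. B i w)) = mean_hit N \<omega> 0 - u n" for n
    by (induction n) (auto simp: u0 u_Suc)
  have f_nonneg: "0 \<le> f n x" for n x by (simp add: f_def)
  have u_nonneg: "0 \<le> u n" for n
    unfolding u_def using f_nonneg mean_hit_nonneg[OF \<omega>] by (intro sum_nonneg) auto
  \<comment> \<open>The partial sums of the survival probabilities are bounded because
    \<open>u\<close> is nonnegative. So these probabilities tend to 0 and, by this bound, force
    \<open>u\<close> to 0; finiteness of the expectation is obtained on the way.\<close>
  have u_le: "u n \<le> \<P>(w in M. B n w) * mean_hit N \<omega> 0" for n
    unfolding u_def Bf sum_distrib_right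
    by (intro sum_mono mult_left_mono mean_hit_le[OF \<omega>] f_nonneg)
  have summ: "summable (\<lambda>n. \<P>(w in M. B n w))"
    by (rule summableI_nonneg_bounded[of _ "mean_hit N \<omega> 0"]) (auto simp: partial u_nonneg)
  have "(\<lambda>n. \<P>(w in M. B n w) * mean_hit N \<omega> 0) \<longlonglongrightarrow> 0"
    using tendsto_mult_right[OF summable_LIMSEQ_zero[OF summ]] by simp
  then have "u \<longlonglongrightarrow> 0"
    by (rule tendsto_sandwich[OF _ _ tendsto_const, rotated 2]) (auto simp: u_nonneg u_le)
  then have "(\<lambda>n. mean_hit N \<omega> 0 - u n) \<longlonglongrightarrow> mean_hit N \<omega> 0 - 0"
    by (intro tendsto_intros)
  then have sums: "(\<lambda>n. \<P>(w in M. B n w)) sums mean_hit N \<omega> 0"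
    by (simp add: sums_def partial)

  \<comment> \<open>The expectation of an \<open>enat\<close>-valued variable is the sum of its tail
    probabilities.\<close>
  have "expected_hit M X N = (\<Sum>n. emeasure M {w \<in> space M. enat n < first_hit X N w})"
    unfolding expected_hit_def
    by (rule nn_integral_enat_function[OF measurable_first_hit[OF X_meas]])
  also have "\<dots> = (\<Sum>n. ennreal \<P>(w in M. B n w))"
  proof (intro suminf_cong)
    fix n
    have "emeasure M {w \<in> space M. \<forall>i\<le>n. X i w \<noteq> N} = emeasure M {w \<in> space M. B n w}"
      using survive[of n] by (intro emeasure_eq_AE) auto
    then show "emeasure M {w \<in> space M. enat n < first_hit X N w} = ennreal \<P>(w in M. B n w)"
      by (simp add: less_first_hit_iff emeasure_eq_measure)
  qed
  also have "\<dots> = ennreal (mean_hit N \<omega> 0)"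
    using sums by (intro suminf_ennreal_eq) auto
  finally show ?thesis .
qed

subsection \<open>The periodic environment\<close>

text \<open>For \<open>N = a * k\<close> the \<open>i\<close>-th marked point is the floor of
  \<open>a * i - i / k\<close> with \<open>0 < i / k \<le> 1\<close>, that is
  \<open>a * i - 1\<close>. This offset explains the \<open>Suc x\<close>.\<close>

lemma env_multiple:
  assumes "a \<ge> 1" and "x < a * k"
  shows "env p q (a * k) k x = (if a dvd Suc x then p else q)"
proof -
  have "\<lfloor>real i * ((real (a * k) - 1) / real k)\<rfloor> = int a * int i - 1" if "1 \<le> i" "i \<le> k" for i
  proof (rule floor_unique)
    have eq: "real i * ((real (a * k) - 1) / real k) = real a * real i - real i / real k"
      using that by (simp add: field_simps)
    have "0 < real i / real k" "real i / real k \<le> 1" using that by auto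
    then show "real_of_int (int a * int i - 1) \<le> real i * ((real (a * k) - 1) / real k)"
      and "real i * ((real (a * k) - 1) / real k) < real_of_int (int a * int i - 1) + 1"
      unfolding eq by simp_all
  qed
  then have "(\<exists>i::nat. 1 \<le> i \<and> i \<le> k \<and> int x = \<lfloor>real i * ((real (a * k) - 1) / real k)\<rfloor>) \<longleftrightarrow>
      (\<exists>i. 1 \<le> i \<and> i \<le> k \<and> int x = int a * int i - 1)"
    by (auto cong: conj_cong)
  also have "\<dots> \<longleftrightarrow> (\<exists>i. 1 \<le> i \<and> i \<le> k \<and> Suc x = a * i)"
  proof -
    have "int x = int a * int i - 1 \<longleftrightarrow> Suc x = a * i" for i
      using of_nat_eq_iff[of "Suc x" "a * i", where 'a = int] by (auto simp del: of_nat_eq_iff)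
    then show ?thesis by simp
  qed
  also have "\<dots> \<longleftrightarrow> a dvd Suc x"
  proof
    assume "a dvd Suc x"
    then obtain i where i: "Suc x = a * i" by (auto elim: dvdE)
    then have "1 \<le> i" by (cases i) auto
    moreover have "i \<le> k" using i assms by (metis Suc_leI mult_le_cancel1 not_one_le_zero neq0_conv)
    ultimately show "\<exists>i. 1 \<le> i \<and> i \<le> k \<and> Suc x = a * i" using i by blast
  qed auto
  finally show ?thesis by (simp add: env_def)
qed

section \<open>Averages over a period\<close>

lemma sum_periodic:
  fixes g :: "nat \<Rightarrow> real"
  assumes "\<And>x. g (x + a) = g x"
  shows "(\<Sum>x<a * k. g x) = real k * (\<Sum>x<a. g x)"
proof (induction k)
  case (Suc k)
  have shift: "g (x + a * k) = g x" for x
    by (induction k) (auto simp: assms add.assoc[symmetric] add.commute[of a])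
  have "(\<Sum>x<a * Suc k. g x) = (\<Sum>x\<in>{0..<a * k}. g x) + (\<Sum>x\<in>{a * k..<a * Suc k}. g x)"
    unfolding lessThan_atLeast0 by (rule sum.atLeastLessThan_concat[symmetric]) auto
  also have "(\<Sum>x\<in>{a * k..<a * Suc k}. g x) = (\<Sum>x\<in>{0..<a}. g (x + a * k))"
    using sum.shift_bounds_nat_ivl[of g 0 "a * k" a] by (simp only: mult_Suc_right add_0)
  finally show ?case using Suc by (simp add: shift lessThan_atLeast0 algebra_simps)
qed simp

text \<open>Shifting by one permutes the residues modulo \<open>a\<close>: the last index
  contributes the exponent 0.\<close>

lemma sum_power_Suc_mod:
  fixes r :: real
  assumes "a \<ge> 1"
  shows "(\<Sum>x<a. r ^ (Suc x mod a)) = (\<Sum>x<a. r ^ x)"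
proof -
  obtain b where b: "a = Suc b" using assms by (cases a) auto
  have "(\<Sum>x<a. r ^ (Suc x mod a)) = (\<Sum>x<b. r ^ Suc x) + 1"
    unfolding b by simp
  also have "\<dots> = (\<Sum>x<a. r ^ x)"
    unfolding b by (subst sum.lessThan_Suc_shift) simp
  finally show ?thesis .
qed

text \<open>The difference of two solutions of the recursion shrinks by a factor of at most \<alpha>
  per step. Its sum therefore stays bounded, so the average of \<open>left_steps\<close> has the
  same limit as that of the periodic solution \<open>f\<close>.\<close>

lemma left_steps_average:
  fixes p q \<alpha> \<beta> :: real
  assumes \<alpha>: "\<alpha> = (1 - q) / q" and \<beta>: "\<beta> = (1 - p) / p" and bnd: "0 \<le> \<beta>" "\<beta> \<le> \<alpha>" "\<alpha> < 1" and "a \<ge> 1"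
  defines "\<omega> \<equiv> \<lambda>x. if a dvd Suc x then p else q"
  defines "G \<equiv> (\<beta> - \<alpha>) / ((1 - \<alpha>) * (1 - \<beta> * \<alpha> ^ (a - 1)))"
  shows "(\<lambda>k. (\<Sum>x<a * k. left_steps \<omega> x) / real (a * k)) \<longlonglongrightarrow>
    \<alpha> / (1 - \<alpha>) + G * (1 - \<alpha> ^ a) / (1 - \<alpha>) / real a"
proof -
  define c where "c = \<alpha> / (1 - \<alpha>)"
  define f where "f x = c + G * \<alpha> ^ (Suc x mod a)" for x
  have \<alpha>0: "0 \<le> \<alpha>" using bnd by linarith
  have "\<alpha> ^ (a - 1) \<le> 1" using bnd \<alpha>0 by (intro power_le_one) auto
  then have "\<beta> * \<alpha> ^ (a - 1) \<le> \<beta> * 1" using bnd by (intro mult_left_mono) auto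
  then have lt: "\<beta> * \<alpha> ^ (a - 1) < 1" using bnd by linarith
  \<comment> \<open>\<open>c\<close> is the fixed point of the recursion with constant factor
    \<alpha>, valid between marked vertices.\<close>
  have c: "c = \<alpha> * (1 + c)" using bnd by (simp add: c_def field_simps)
  \<comment> \<open>\<open>G\<close> is chosen so that the recursion also holds at a marked vertex,
    where the factor is \<beta> and the exponent of \<alpha> falls from \<open>a - 1\<close> back to
    0.\<close>
  have G: "c + G = \<beta> * (1 + c + G * \<alpha> ^ (a - 1))"
  proof -
    have "G * (1 - \<beta> * \<alpha> ^ (a - 1)) = (\<beta> - \<alpha>) / (1 - \<alpha>)" using lt by (simp add: G_def)
    also have "\<dots> = \<beta> * (1 + c) - c"
    proof -
      have "1 + c = 1 / (1 - \<alpha>)" using bnd by (simp add: c_def field_simps)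
      then show ?thesis by (simp add: c_def diff_divide_distrib)
    qed
    finally show ?thesis by (simp add: algebra_simps)
  qed
  define \<rho> where "\<rho> x = (1 - \<omega> x) / \<omega> x" for x
  have \<rho>: "\<rho> x = (if a dvd Suc x then \<beta> else \<alpha>)" for x by (simp add: \<rho>_def \<omega>_def \<alpha> \<beta>)
  have f_Suc: "f (Suc x) = \<rho> (Suc x) * (1 + f x)" for x
  proof (cases "a dvd Suc (Suc x)")
    case True
    then have "Suc (Suc x) mod a = 0" by auto
    moreover from this have "Suc x mod a = a - 1"
      using mod_Suc[of "Suc x" a] by (simp split: if_splits)
    ultimately show ?thesis using True G by (simp add: f_def \<rho> add.assoc)
  next
    case False
    then have "Suc (Suc x) mod a = Suc (Suc x mod a)"
      using mod_Suc[of "Suc x" a] by (simp add: dvd_eq_mod_eq_0 split: if_splits)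
    then show ?thesis using False c by (simp add: f_def \<rho> algebra_simps)
  qed
  \<comment> \<open>The initial deviation is \<open>\<bar>f 0\<bar>\<close> because
    \<open>left_steps\<close> vanishes at 0.\<close>
  have diff: "\<bar>left_steps \<omega> x - f x\<bar> \<le> \<bar>f 0\<bar> * \<alpha> ^ x" for x
  proof (induction x)
    case (Suc x)
    have "left_steps \<omega> (Suc x) - f (Suc x) = \<rho> (Suc x) * (left_steps \<omega> x - f x)"
      by (simp add: f_Suc \<rho>_def right_diff_distrib[symmetric] del: times_divide_eq_left)
    then have "\<bar>left_steps \<omega> (Suc x) - f (Suc x)\<bar> = \<rho> (Suc x) * \<bar>left_steps \<omega> x - f x\<bar>"
      using bnd \<alpha>0 by (simp add: abs_mult \<rho>)
    also have "\<dots> \<le> \<alpha> * (\<bar>f 0\<bar> * \<alpha> ^ x)"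
      using Suc bnd \<alpha>0 by (intro mult_mono) (auto simp: \<rho>)
    finally show ?case by (simp add: algebra_simps)
  qed simp
  define D where "D k = (\<Sum>x<a * k. left_steps \<omega> x - f x)" for k
  have D: "\<bar>D k\<bar> \<le> \<bar>f 0\<bar> / (1 - \<alpha>)" for k
  proof -
    have "\<bar>D k\<bar> \<le> (\<Sum>x<a * k. \<bar>f 0\<bar> * \<alpha> ^ x)"
      unfolding D_def by (rule order_trans[OF sum_abs]) (intro sum_mono diff)
    also have "\<dots> = \<bar>f 0\<bar> * ((1 - \<alpha> ^ (a * k)) / (1 - \<alpha>))"
      using bnd by (simp add: sum_distrib_left[symmetric] sum_gp_strict)
    also have "\<dots> \<le> \<bar>f 0\<bar> * (1 / (1 - \<alpha>))"
      using bnd \<alpha>0 by (intro mult_left_mono divide_right_mono) auto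
    finally show ?thesis by simp
  qed
  have "filterlim (\<lambda>k. real (a * k)) at_top sequentially"
    using \<open>a \<ge> 1\<close> by real_asymp
  then have "(\<lambda>k. \<bar>f 0\<bar> / (1 - \<alpha>) / real (a * k)) \<longlonglongrightarrow> 0"
    by (intro tendsto_divide_0[OF tendsto_const] filterlim_at_top_imp_at_infinity)
  then have D0: "(\<lambda>k. D k / real (a * k)) \<longlonglongrightarrow> 0"
  proof (rule Lim_null_comparison[rotated])
    have "norm (D k / real (a * k)) \<le> \<bar>f 0\<bar> / (1 - \<alpha>) / real (a * k)" for k
      unfolding real_norm_def abs_divide abs_of_nat by (intro divide_right_mono D) simp
    then show "\<forall>\<^sub>F k in sequentially. norm (D k / real (a * k)) \<le> \<bar>f 0\<bar> / (1 - \<alpha>) / real (a * k)"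
      by simp
  qed
  define S where "S = real a * c + G * (1 - \<alpha> ^ a) / (1 - \<alpha>)"
  have "(\<Sum>x<a. f x) = S"
    using bnd sum_power_Suc_mod[OF \<open>a \<ge> 1\<close>, of \<alpha>]
    by (simp add: f_def S_def sum.distrib sum_distrib_left[symmetric] sum_gp_strict)
  then have "(\<Sum>x<a * k. f x) = real k * S" for k
    using sum_periodic[of f a k] by (simp add: f_def flip: add_Suc)
  then have sum_eq: "(\<Sum>x<a * k. left_steps \<omega> x) = D k + real k * S" for k
    by (simp add: D_def sum_subtractf)
  have "(\<lambda>k. D k / real (a * k) + S / real a) \<longlonglongrightarrow> 0 + S / real a"
    by (intro tendsto_intros D0)
  \<comment> \<open>The index \<open>k = 0\<close> is left out because of the division by
    \<open>a * k\<close>.\<close>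
  moreover have "\<forall>\<^sub>F k in sequentially.
      D k / real (a * k) + S / real a = (\<Sum>x<a * k. left_steps \<omega> x) / real (a * k)"
    using eventually_ge_at_top[of 1]
    by eventually_elim (use \<open>a \<ge> 1\<close> in \<open>simp add: sum_eq add_divide_distrib\<close>)
  ultimately have "(\<lambda>k. (\<Sum>x<a * k. left_steps \<omega> x) / real (a * k)) \<longlonglongrightarrow> S / real a"
    using Lim_transform_eventually by fastforce
  moreover have "S / real a = \<alpha> / (1 - \<alpha>) + G * (1 - \<alpha> ^ a) / (1 - \<alpha>) / real a"
    using \<open>a \<ge> 1\<close> by (simp add: S_def c_def add_divide_distrib)
  ultimately show ?thesis by simp
qed

section \<open>The limit and its closed form\<close>

theorem proposition4:
  fixes p q \<alpha> \<beta> :: real and a :: nat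
    and M :: "nat \<Rightarrow> 'w measure" and X :: "nat \<Rightarrow> nat \<Rightarrow> 'w \<Rightarrow> nat"
  assumes "1 / 2 < q" and "q < p" and "p \<le> 1"
    and "\<alpha> = (1 - q) / q" and "\<beta> = (1 - p) / p"
    and "a \<ge> 1"
    and "\<And>k. k \<ge> 1 \<Longrightarrow> reflected_walk (M k) (X k) (a * k) (env p q (a * k) k) 0"
  shows "(\<lambda>k. enn2ereal (expected_hit (M k) (X k) (a * k)) / ereal (real (a * k)))
    \<longlonglongrightarrow> ereal (1 + 2 / real a *
      ((\<alpha> ^ (a + 2) - real a * \<alpha> ^ 3 + (real a - 1) * \<alpha> ^ 2
          + ((real a * \<alpha> ^ 2 - (real a + 1) * \<alpha>) * \<alpha> ^ a + \<alpha>) * \<beta>)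
       / (\<alpha> ^ 3 - 2 * \<alpha> ^ 2 + \<alpha> - (\<alpha> ^ 2 - 2 * \<alpha> + 1) * \<alpha> ^ a * \<beta>)))"
proof -
  have \<alpha>: "0 < \<alpha>" "\<alpha> < 1" using assms(1-3) by (auto simp: assms(4) divide_simps)
  have \<beta>: "0 \<le> \<beta>" using assms(1-3,5) by simp
  have \<beta>\<alpha>: "\<beta> \<le> \<alpha>" using assms(1-3) unfolding assms(4,5) by (intro frac_le) auto
  define \<omega> where "\<omega> = (\<lambda>x. if a dvd Suc x then p else q)"
  define G where "G = (\<beta> - \<alpha>) / ((1 - \<alpha>) * (1 - \<beta> * \<alpha> ^ (a - 1)))"
  define L where "L = \<alpha> / (1 - \<alpha>) + G * (1 - \<alpha> ^ a) / (1 - \<alpha>) / real a"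
  have "(\<lambda>k. (\<Sum>x<a * k. left_steps \<omega> x) / real (a * k)) \<longlonglongrightarrow> L"
    unfolding \<omega>_def L_def G_def
    by (rule left_steps_average[OF assms(4,5) \<beta> \<beta>\<alpha> \<alpha>(2) assms(6)])
  then have lim: "(\<lambda>k. ereal (1 + 2 * ((\<Sum>x<a * k. left_steps \<omega> x) / real (a * k))))
      \<longlonglongrightarrow> ereal (1 + 2 * L)"
    by (intro tendsto_intros)
  have eq: "enn2ereal (expected_hit (M k) (X k) (a * k)) / ereal (real (a * k)) =
      ereal (1 + 2 * ((\<Sum>x<a * k. left_steps \<omega> x) / real (a * k)))" if "k \<ge> 1" for k
  proof -
    let ?e = "env p q (a * k) k"
    have N: "a * k \<ge> 1" using that assms(6) by simp
    have e: "?e i = \<omega> i" if "i < a * k" for i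
      using env_multiple[OF assms(6) that] by (simp add: \<omega>_def)
    have e01: "0 < ?e i \<and> ?e i \<le> 1" if "i < a * k" for i
      using assms(1-3) by (simp add: e[OF that] \<omega>_def)
    have hit: "expected_hit (M k) (X k) (a * k) = ennreal (mean_hit (a * k) ?e 0)"
      by (rule expected_hit_eq_mean_hit[OF assms(7)[OF that] N e01])
    have "mean_hit (a * k) ?e 0 = (\<Sum>x<a * k. 1 + 2 * left_steps \<omega> x)"
      unfolding mean_hit_def atLeast0LessThan
      using left_steps_cong[of "a * k" ?e \<omega>] e by (intro sum.cong) auto
    also have "\<dots> = real (a * k) + 2 * (\<Sum>x<a * k. left_steps \<omega> x)"
      by (simp add: sum.distrib sum_distrib_left)
    finally have "mean_hit (a * k) ?e 0 / real (a * k) =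
        1 + 2 * ((\<Sum>x<a * k. left_steps \<omega> x) / real (a * k))"
      using N by (simp add: add_divide_distrib)
    \<comment> \<open>Nonnegativity ensures that \<open>ennreal\<close> does not truncate the value
      to 0.\<close>
    moreover have "0 \<le> mean_hit (a * k) ?e 0" by (rule mean_hit_nonneg[OF e01])
    ultimately show ?thesis using N by (simp add: hit enn2ereal_ennreal)
  qed
  have "1 + 2 * L = 1 + 2 / real a *
      ((\<alpha> ^ (a + 2) - real a * \<alpha> ^ 3 + (real a - 1) * \<alpha> ^ 2
          + ((real a * \<alpha> ^ 2 - (real a + 1) * \<alpha>) * \<alpha> ^ a + \<alpha>) * \<beta>)
       / (\<alpha> ^ 3 - 2 * \<alpha> ^ 2 + \<alpha> - (\<alpha> ^ 2 - 2 * \<alpha> + 1) * \<alpha> ^ a * \<beta>))" (is "_ = 1 + 2 / real a * (?n / ?d)")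
  proof -
    \<comment> \<open>\<open>G\<close> contains the power \<open>a - 1\<close>; with
      \<open>a = Suc b\<close> all powers become polynomial in \<alpha> and
      \<open>t\<close>.\<close>
    obtain b where b: "a = Suc b" using assms(6) by (cases a) auto
    define t where "t = \<alpha> ^ b"
    have at: "\<alpha> ^ a = \<alpha> * t" by (simp add: b t_def)
    have "t \<le> 1" unfolding t_def using \<alpha> by (intro power_le_one) auto
    then have "\<beta> * t \<le> \<beta> * 1" using \<beta> by (intro mult_left_mono)
    then have t: "1 - \<beta> * t > 0" using \<beta>\<alpha> \<alpha> by linarith
    have a: "real a > 0" using assms(6) by simp
    \<comment> \<open>Both parts of the fraction are factored to expose the factors that cancel. The
      two summands of the numerator yield the constant part \<alpha> / (1 - \<alpha>) and the
      \<open>G\<close> part of \<open>L\<close>, each multiplied by \<open>a\<close>.\<close>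
    have d: "?d = \<alpha> * (1 - \<alpha>) ^ 2 * (1 - \<beta> * t)"
      unfolding at by algebra
    have n: "?n = real a * \<alpha> ^ 2 * (1 - \<alpha>) * (1 - \<beta> * t) + \<alpha> * (\<beta> - \<alpha>) * (1 - \<alpha> * t)"
      unfolding power_add at by algebra
    have "?n / ?d = real a * \<alpha> / (1 - \<alpha>) + (\<beta> - \<alpha>) * (1 - \<alpha> * t) / ((1 - \<alpha>) ^ 2 * (1 - \<beta> * t))"
      unfolding n d add_divide_distrib using \<alpha> t by (simp add: power2_eq_square)
    also have "\<dots> = real a * L"
      using a by (simp add: L_def G_def at b[symmetric] distrib_left power2_eq_square)
        (simp add: b t_def)
    finally show ?thesis using a by simp
  qed
  moreover have "(\<lambda>k. enn2ereal (expected_hit (M k) (X k) (a * k)) / ereal (real (a * k)))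
      \<longlonglongrightarrow> ereal (1 + 2 * L)"
    using lim
  proof (rule Lim_transform_eventually)
    show "\<forall>\<^sub>F k in sequentially. ereal (1 + 2 * ((\<Sum>x<a * k. left_steps \<omega> x) / real (a * k))) =
        enn2ereal (expected_hit (M k) (X k) (a * k)) / ereal (real (a * k))"
      using eventually_ge_at_top[of 1] by eventually_elim (rule eq[symmetric])
  qed
  ultimately show ?thesis by simp
qed

end
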